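(* Let $F$ be a field of characteristic not $2$ and let $R$ be a unital commutative associative $F$-algebra which is an integral domain. Let $$X=\begin{pmatrix}X_1&X_2\\ X_3&-X_1\end{pmatrix},\quad H=\begin{pmatrix}H_1&H_2\\ H_3&-H_1\end{pmatrix},\quad Y=\begin{pmatrix}Y_1&Y_2\\ Y_3&-Y_1\end{pmatrix}$$ be elements of $\mathfrak{sl}_2(R)$ such that $(X,H,Y)$ is an $s\ell_2$-triple. Then: (1) $H_1^2+H_2H_3=1$; (2) $X_1^2+X_2X_3=0$; (3) $Y_1^2+Y_2Y_3=0$; (4) $H^2=I$, where $I$ is the $2\times 2$ identity matrix.
   Context: $\mathfrak{sl}_2(R)$ denotes the set of $2\times 2$ matrices $\begin{pmatrix}a&b\\ c&-a\end{pmatrix}$ with $a,b,c\in R$, viewed as a Lie algebra over $F$ under the commutator bracket. A triple $(e,h,f)$ of nonzero elements of a Lie algebra is called an $s\ell_2$-triple if $[h,e]=2e$, $[h,f]=-2f$, $[e,f]=h$. *)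

theory Defs
  imports "HOL-Analysis.Analysis"
begin

text \<open>
  Multiplication of the type-class ring is commutative, so compatibility of the scalar action
  with multiplication in one argument suffices.
\<close>

locale comm_unital_algebra = vector_space smul
  for smul :: "'f::field \<Rightarrow> 'r::comm_ring_1 \<Rightarrow> 'r" +
  assumes scale_mult_left: "smul c (x * y) = smul c x * y"

locale lie_algebra = vector_space smul
  for smul :: "'f::field \<Rightarrow> 'v::ab_group_add \<Rightarrow> 'v" +
  fixes L :: "'v set" and bracket :: "'v \<Rightarrow> 'v \<Rightarrow> 'v"
  assumes subspace_carrier: "subspace L"
    and bracket_closed: "x \<in> L \<Longrightarrow> y \<in> L \<Longrightarrow> bracket x y \<in> L"
    and bracket_add_left:
      "x \<in> L \<Longrightarrow> y \<in> L \<Longrightarrow> z \<in> L \<Longrightarrow> bracket (x + y) z = bracket x z + bracket y z"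
    and bracket_add_right:
      "x \<in> L \<Longrightarrow> y \<in> L \<Longrightarrow> z \<in> L \<Longrightarrow> bracket x (y + z) = bracket x y + bracket x z"
    and bracket_scale_left:
      "x \<in> L \<Longrightarrow> y \<in> L \<Longrightarrow> bracket (smul c x) y = smul c (bracket x y)"
    and bracket_scale_right:
      "x \<in> L \<Longrightarrow> y \<in> L \<Longrightarrow> bracket x (smul c y) = smul c (bracket x y)"
    and bracket_self: "x \<in> L \<Longrightarrow> bracket x x = 0"
    and jacobi:
      "x \<in> L \<Longrightarrow> y \<in> L \<Longrightarrow> z \<in> L \<Longrightarrow>
        bracket x (bracket y z) + bracket y (bracket z x) + bracket z (bracket x y) = 0"
begin

definition sl2_triple :: "'v \<Rightarrow> 'v \<Rightarrow> 'v \<Rightarrow> bool" where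
  "sl2_triple e h f \<longleftrightarrow>
     e \<in> L \<and> h \<in> L \<and> f \<in> L \<and> e \<noteq> 0 \<and> h \<noteq> 0 \<and> f \<noteq> 0 \<and>
     bracket h e = smul 2 e \<and> bracket h f = smul (- 2) f \<and> bracket e f = h"

end

definition sl2_mat :: "'r::comm_ring_1 \<Rightarrow> 'r \<Rightarrow> 'r \<Rightarrow> 'r^2^2" where
  "sl2_mat a b c = vector [vector [a, b], vector [c, - a]]"

definition sl2 :: "('r::comm_ring_1^2^2) set" where
  "sl2 = {sl2_mat a b c | a b c. True}"

text \<open>
  The matrix product is \<open>**\<close> and the identity matrix is \<open>mat 1\<close>; the type-class
  operations \<open>*\<close>, \<open>^\<close> and \<open>1\<close> on these types are componentwise.
\<close>

definition commutator :: "'r::comm_ring_1^2^2 \<Rightarrow> 'r^2^2 \<Rightarrow> 'r^2^2" where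
  "commutator A B = A ** B - B ** A"

definition mat_scale :: "('f \<Rightarrow> 'r \<Rightarrow> 'r) \<Rightarrow> 'f \<Rightarrow> 'r^2^2 \<Rightarrow> 'r^2^2" where
  "mat_scale smul c = map_matrix (smul c)"

lemma map_matrix_nth [simp]: "map_matrix g A $ i $ j = g (A $ i $ j)"
  by (simp add: map_matrix_def)

lemma mem_sl2_iff: "A \<in> sl2 \<longleftrightarrow> A $ 2 $ 2 = - (A $ 1 $ 1)"
proof
  assume "A $ 2 $ 2 = - (A $ 1 $ 1)"
  then have "A = sl2_mat (A $ 1 $ 1) (A $ 1 $ 2) (A $ 2 $ 1)"
    by (simp add: sl2_mat_def vec_eq_iff forall_2)
  then show "A \<in> sl2"
    unfolding sl2_def by blast
qed (auto simp: sl2_def sl2_mat_def)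

lemma (in comm_unital_algebra) lie_algebra_sl2:
  "lie_algebra (mat_scale smul) (sl2 :: ('r^2^2) set) commutator"
proof -
  interpret M: vector_space "mat_scale smul :: 'f \<Rightarrow> 'r^2^2 \<Rightarrow> 'r^2^2"
    by unfold_locales
      (simp_all add: mat_scale_def vec_eq_iff scale_right_distrib scale_left_distrib)
  have mult_left: "smul c x * y = smul c (x * y)" and mult_right: "x * smul c y = smul c (x * y)"
    for c x y
    by (metis scale_mult_left mult.commute)+
  show ?thesis
  proof unfold_locales
    show "M.subspace sl2"
      by (auto simp: M.subspace_def mem_sl2_iff mat_scale_def)
  next
    fix x y z :: "'r^2^2"
    show "commutator x (commutator y z) + commutator y (commutator z x)
        + commutator z (commutator x y) = 0"
      by (simp add: commutator_def vec_eq_iff forall_2 matrix_matrix_mult_def sum_2 algebra_simps)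
  next
    fix x y :: "'r^2^2" and c
    show "commutator (mat_scale smul c x) y = mat_scale smul c (commutator x y)"
      by (simp add: commutator_def mat_scale_def vec_eq_iff forall_2 matrix_matrix_mult_def sum_2
          scale_right_distrib scale_right_diff_distrib mult_left mult_right)
    show "commutator x (mat_scale smul c y) = mat_scale smul c (commutator x y)"
      by (simp add: commutator_def mat_scale_def vec_eq_iff forall_2 matrix_matrix_mult_def sum_2
          scale_right_distrib scale_right_diff_distrib mult_left mult_right)
  qed (simp_all add: mem_sl2_iff commutator_def vec_eq_iff forall_2 matrix_matrix_mult_def sum_2
      algebra_simps)
qed

end

theory Submission
  imports Defs
begin

text \<open>
  The relations \<open>[H, X] = 2X\<close> and \<open>[H, Y] = - 2Y\<close> make \<open>X\<close> and \<open>Y\<close> eigenvectors of \<open>ad H\<close>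
  with eigenvalues \<open>2s\<close>, where \<open>s = 1\<close> and \<open>s = - 1\<close>, and \<open>2\<close> can be cancelled in \<open>R\<close>.
  Let \<open>A \<noteq> 0\<close> be traceless with \<open>[H, A] = 2sA\<close>. Since \<open>tr (B[H, A])\<close> vanishes for \<open>B = A\<close> and for
  \<open>B = H\<close>, it follows that \<open>2s tr (A\<^sup>2) = 0\<close> and \<open>2s tr (HA) = 0\<close>. For a traceless \<open>2 \<times> 2\<close> matrix,
  \<open>A\<^sup>2\<close> is the scalar \<open>a\<^sup>2 + bc\<close>, half of its trace, so the first equation gives \<open>A\<^sup>2 = 0\<close>. Polarising,
  \<open>HA + AH\<close> is the scalar \<open>tr (HA)\<close>, so the second gives \<open>HA = - AH\<close>. Together with
  \<open>HA - AH = 2sA\<close> this means \<open>HA = sA\<close>. Hence \<open>H\<^sup>2A = s\<^sup>2A\<close>; as \<open>H\<^sup>2\<close> is a scalar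
  and \<open>A \<noteq> 0\<close>, that scalar is \<open>s\<^sup>2 = 1\<close>. The argument is \<open>ad_eigenvector_sl2\<close> below.
\<close>

lemma sl2_mat_square:
  "sl2_mat a b c ** sl2_mat a b c = mat (a\<^sup>2 + b * c)"
  by (simp add: sl2_mat_def vec_eq_iff forall_2 matrix_matrix_mult_def sum_2 mat_def
      power2_eq_square algebra_simps)

lemma sl2_mat_eq_0_iff: "sl2_mat a b c = 0 \<longleftrightarrow> a = 0 \<and> b = 0 \<and> c = 0"
  by (auto simp: sl2_mat_def vec_eq_iff forall_2)

text \<open>
  In entries, \<open>2 * h * a + k * c + l * b\<close> is \<open>tr (HA)\<close> for \<open>H = sl2_mat h k l\<close> and
  \<open>A = sl2_mat a b c\<close>, while \<open>a\<^sup>2 + b * c\<close> and \<open>h\<^sup>2 + k * l\<close> are the scalars \<open>A\<^sup>2\<close> and \<open>H\<^sup>2\<close>.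
\<close>

lemma ad_eigenvector_sl2:
  fixes s :: "'r::idom"
  assumes two: "(2::'r) \<noteq> 0" and s: "s \<noteq> 0"
    and nonzero: "sl2_mat a b c \<noteq> 0"
    and eigen: "commutator (sl2_mat h k l) (sl2_mat a b c) = map_matrix ((*) (2 * s)) (sl2_mat a b c)"
  shows "a\<^sup>2 + b * c = 0" and "h\<^sup>2 + k * l = s\<^sup>2"
proof -
  have "h * a + k * c - (a * h + b * l) = 2 * s * a"
    and "h * b - k * a - (a * k - b * h) = 2 * s * b"
    and "l * a - h * c - (c * h - a * l) = 2 * s * c"
    using eigen
    by (simp_all add: commutator_def sl2_mat_def vec_eq_iff forall_2 matrix_matrix_mult_def sum_2)
  then have diag: "k * c - b * l = 2 * s * a"
    and "2 * (h * b - a * k) = 2 * (s * b)" and "2 * (l * a - h * c) = 2 * (s * c)"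
    by algebra+
  with two have upper: "h * b - a * k = s * b" and lower: "l * a - h * c = s * c"
    by (metis mult_left_cancel)+

  have "2 * s * (a\<^sup>2 + b * c) = a * (2 * s * a) + c * (s * b) + b * (s * c)"
    by (simp add: power2_eq_square algebra_simps)
  also have "\<dots> = 0"
    unfolding diag [symmetric] upper [symmetric] lower [symmetric] by (simp add: algebra_simps)
  finally show "a\<^sup>2 + b * c = 0"
    using two s by simp

  have "s * (2 * h * a + k * c + l * b) = h * (2 * s * a) + k * (s * c) + l * (s * b)"
    by (simp add: algebra_simps)
  also have "\<dots> = 0"
    unfolding diag [symmetric] upper [symmetric] lower [symmetric] by (simp add: algebra_simps)
  finally have trace: "2 * h * a + k * c + l * b = 0"
    using s by simp
  \<comment> \<open>The diagonal entries of \<open>HA = sA\<close>; the other two are \<open>upper\<close> and \<open>lower\<close>.\<close>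
  have "2 * (h * a + k * c) = 2 * (s * a)" and "2 * (l * b + h * a) = 2 * (- (s * a))"
    using trace diag by algebra+
  with two have HA11: "h * a + k * c = s * a" and HA22: "l * b + h * a = - (s * a)"
    by (metis mult_left_cancel)+
  have "(h\<^sup>2 + k * l) * a = s\<^sup>2 * a" "(h\<^sup>2 + k * l) * b = s\<^sup>2 * b" "(h\<^sup>2 + k * l) * c = s\<^sup>2 * c"
    using HA11 HA22 upper lower by algebra+
  with nonzero show "h\<^sup>2 + k * l = s\<^sup>2"
    unfolding sl2_mat_eq_0_iff by (metis mult_right_cancel)
qed

lemma (in comm_unital_algebra) mat_scale_of_int:
  "mat_scale smul (of_int n) A = map_matrix ((*) (of_int n)) A"
proof -
  have of_nat: "smul (of_nat m) x = of_nat m * x" for m x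
    by (induction m) (simp_all add: scale_left_distrib distrib_right)
  have "smul (of_int n) x = of_int n * x" for x
    by (cases n) (simp_all only: of_int_of_nat_eq of_int_minus of_nat scale_minus_left
        mult_minus_left)
  then show ?thesis
    by (simp add: mat_scale_def vec_eq_iff)
qed

text \<open>
  The structure map \<open>F \<rightarrow> R\<close> sends the unit \<open>2\<close> to \<open>2\<close>, so \<open>2\<close> acts invertibly on \<open>R\<close>.
\<close>

lemma (in comm_unital_algebra) two_neq_zero:
  assumes "CHAR('f) \<noteq> 2"
  shows "(2::'r) \<noteq> 0"
proof
  assume "(2::'r) = 0"
  then have "smul 2 (1::'r) = 0"
    using scale_left_distrib [of 1 1 1] by simp
  then have "(2::'f) = 0"
    by simp
  then have "of_nat 2 = (0::'f)"
    by simp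
  then have "CHAR('f) dvd 2"
    by (simp only: of_nat_eq_0_iff_char_dvd)
  with assms have "CHAR('f) = 1"
    using prime_nat_iff two_is_prime_nat by blast
  then show False
    by (metis of_nat_1 of_nat_CHAR zero_neq_one)
qed

theorem lemma1:
  fixes smul :: "'f::field \<Rightarrow> 'r::idom \<Rightarrow> 'r"
    and X H Y :: "'r^2^2"
    and X1 X2 X3 H1 H2 H3 Y1 Y2 Y3 :: 'r
  assumes "CHAR('f) \<noteq> 2"
    and "comm_unital_algebra smul"
    and "X = sl2_mat X1 X2 X3"
    and "H = sl2_mat H1 H2 H3"
    and "Y = sl2_mat Y1 Y2 Y3"
    and "lie_algebra.sl2_triple (mat_scale smul) sl2 commutator X H Y"
  shows "H1\<^sup>2 + H2 * H3 = 1 \<and>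
         X1\<^sup>2 + X2 * X3 = 0 \<and>
         Y1\<^sup>2 + Y2 * Y3 = 0 \<and>
         H ** H = mat 1"
proof -
  interpret comm_unital_algebra smul
    by fact
  interpret L: lie_algebra "mat_scale smul" "sl2 :: ('r^2^2) set" commutator
    by (rule lie_algebra_sl2)
  have two: "(2::'r) \<noteq> 0"
    using assms(1) by (rule two_neq_zero)
  have X: "X \<noteq> 0" "commutator H X = map_matrix ((*) (2 * 1)) X"
    and Y: "Y \<noteq> 0" "commutator H Y = map_matrix ((*) (2 * (- 1))) Y"
    using assms(6) mat_scale_of_int [of 2] mat_scale_of_int [of "- 2"]
    by (simp_all add: L.sl2_triple_def)
  have X0: "X1\<^sup>2 + X2 * X3 = 0" and H1: "H1\<^sup>2 + H2 * H3 = 1"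
    using ad_eigenvector_sl2 [OF two one_neq_zero X [unfolded assms(3,4)]] by simp_all
  have Y0: "Y1\<^sup>2 + Y2 * Y3 = 0"
    using ad_eigenvector_sl2(1) [OF two _ Y [unfolded assms(4,5)]] by simp
  have "H ** H = mat 1"
    by (simp add: assms(4) sl2_mat_square H1)
  with X0 H1 Y0 show ?thesis
    by blast
qed

end
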